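(* Consider 8-move peg solitaire on $Diamond(4)$. Then: (1) The central game (start with every hole occupied except the center $d4$, finish with a single peg at $d4$) cannot be solved in fewer than 10 moves. (2) No single vacancy to single survivor problem (start with every hole occupied except one hole, finish with exactly one peg anywhere) can be solved in fewer than 8 moves.
   Context: $Diamond(4)$ has columns a–g (identified with $x=1,\dots,7$) and rows 1–7 ($y=1,\dots,7$), and consists of the 25 holes $(x,y)$ with $|x-4|+|y-4|\le 3$; its center is $d4$. Each hole is empty or holds one peg. In 8-move solitaire a jump takes a peg at hole $p$, with hole $p+v$ occupied and $p+2v$ empty, where $v$ is one of the 8 horizontal, vertical or diagonal unit steps and all three holes lie on the board; the peg moves to $p+2v$ and the peg at $p+v$ is removed. A move is a maximal sequence of one or more consecutive jumps made by the same peg; the length of a solution is its number of moves. *)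

theory Defs
  imports Main "HOL-Library.Product_Plus"
begin

type_synonym hole = "int \<times> int"

definition diamond4 :: "hole set" where
  "diamond4 = {(x, y). \<bar>x - 4\<bar> + \<bar>y - 4\<bar> \<le> 3}"

definition center :: hole where
  "center = (4, 4)"

definition directions :: "(int \<times> int) set" where
  "directions = ({-1, 0, 1} \<times> {-1, 0, 1}) - {(0, 0)}"

text \<open>The jump \<open>(p, v)\<close> takes the peg at \<open>p\<close> over \<open>p + v\<close> into \<open>p + v + v\<close>.
  A position is the set of occupied holes.\<close>

type_synonym jump = "hole \<times> (int \<times> int)"

fun landing :: "jump \<Rightarrow> hole" where
  "landing (p, v) = p + v + v"

fun legal_jump :: "hole set \<Rightarrow> jump \<Rightarrow> bool" where
  "legal_jump A (p, v) \<longleftrightarrow>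
     v \<in> directions \<and> {p, p + v, p + v + v} \<subseteq> diamond4 \<and>
     p \<in> A \<and> p + v \<in> A \<and> p + v + v \<notin> A"

fun do_jump :: "hole set \<Rightarrow> jump \<Rightarrow> hole set" where
  "do_jump A (p, v) = insert (p + v + v) (A - {p, p + v})"

fun jumps_lead :: "hole set \<Rightarrow> jump list \<Rightarrow> hole set \<Rightarrow> bool" where
  "jumps_lead A [] B \<longleftrightarrow> A = B"
| "jumps_lead A (j # js) B \<longleftrightarrow> legal_jump A j \<and> jumps_lead (do_jump A j) js B"

text \<open>Two immediately consecutive jumps are made by the same peg iff the second starts
  in the hole where the first one landed.\<close>

definition same_peg :: "jump \<Rightarrow> jump \<Rightarrow> bool" where
  "same_peg j k \<longleftrightarrow> fst k = landing j"

text \<open>The second clause of the following definition expresses that the moves are maximal: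
  of two successive moves, the later one is not a continuation of the earlier one by the same
  peg. Hence \<open>ms\<close> is determined by the jump sequence \<open>concat ms\<close>.\<close>

definition move_sequence :: "jump list list \<Rightarrow> bool" where
  "move_sequence ms \<longleftrightarrow>
     (\<forall>m \<in> set ms. m \<noteq> [] \<and> successively same_peg m) \<and>
     successively (\<lambda>m m'. \<not> same_peg (last m) (hd m')) ms"

definition solution :: "hole set \<Rightarrow> hole set \<Rightarrow> jump list list \<Rightarrow> bool" where
  "solution A B ms \<longleftrightarrow> move_sequence ms \<and> jumps_lead A (concat ms) B"

end

theory Submission
  imports Defs
begin

text \<open>
  A region is a Merson region if no jump over one of its holes has both other holes outside it.
  As long as such a region is full, the first jump that affects it must start in it, and as the
  jumping peg has not moved before, this jump opens a move. The four corners and the four pairs of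
  inner holes of the edges are eight disjoint Merson regions, so the full ones among
  them bound the number of moves from below.

  In the central game all eight regions are full at the start. The first and the last jump land in
  the center, and jumps preserve the parities of both coordinates, so the first and the last move start
  in holes with even coordinates, which no region contains: they add two to the bound of eight.

  A vacancy outside the regions gives the bound 8 at once. In the other cases seven regions are
  full, and in a solution with seven moves the bound must stay tight: each move starts in a full
  region and makes the bound drop by one. This leaves so few positions that a search
  refutes them all.
\<close>

section \<open>Merson regions and the moves that break into them\<close>

definition is_move :: "jump list \<Rightarrow> bool" where
  "is_move m \<longleftrightarrow> m \<noteq> [] \<and> successively same_peg m"

definition start :: "jump list \<Rightarrow> hole" where
  "start m = fst (hd m)"

definition merson_region :: "hole set \<Rightarrow> bool" where
  "merson_region R \<longleftrightarrow>
     (\<forall>q \<in> R. \<forall>v \<in> directions. q - v \<in> diamond4 \<and> q + v \<in> diamond4 \<longrightarrow>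
        q - v \<in> R \<or> q + v \<in> R)"

lemma jumps_lead_append:
  "jumps_lead A (js @ ks) C \<longleftrightarrow> (\<exists>B. jumps_lead A js B \<and> jumps_lead B ks C)"
  by (induction A js C rule: jumps_lead.induct) auto

text \<open>A full region offers no hole to land in, and jumping over one of its holes would put the
  start or the landing in it. The second conclusion makes the argument repeatable for the next jump
  of the same peg.\<close>

lemma merson_region_jump:
  assumes "merson_region R" "R \<subseteq> A" "legal_jump A j" "fst j \<notin> R"
  shows "R \<subseteq> do_jump A j" "landing j \<notin> R"
proof -
  obtain p v where j: "j = (p, v)"
    by (cases j)
  have land: "p + v + v \<notin> R"
    using assms j by auto
  have "p + v \<notin> R"
  proof
    assume "p + v \<in> R"
    moreover have "v \<in> directions" "p + v - v \<in> diamond4" "p + v + v \<in> diamond4"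
      using assms(3) j by auto
    ultimately have "p + v - v \<in> R \<or> p + v + v \<in> R"
      using assms(1) unfolding merson_region_def by blast
    then show False
      using assms(4) j land by simp
  qed
  then show "R \<subseteq> do_jump A j" "landing j \<notin> R"
    using assms j land by auto
qed

text \<open>Only the start of the move matters: each later jump begins where the previous one
  landed, which is again outside \<open>R\<close>.\<close>

lemma merson_region_move:
  assumes "merson_region R" "R \<subseteq> A" "is_move m" "jumps_lead A m B" "start m \<notin> R"
  shows "R \<subseteq> B \<and> landing (last m) \<notin> R"
  using assms(2-)
proof (induction m arbitrary: A)
  case Nil
  then show ?case by (simp add: is_move_def)
next
  case (Cons j js)
  then have j: "R \<subseteq> do_jump A j" "landing j \<notin> R"
    using merson_region_jump[OF assms(1), of A j] by (simp_all add: start_def)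
  show ?case
  proof (cases js)
    case Nil
    then show ?thesis using j Cons.prems by auto
  next
    case (Cons k ks)
    have "is_move js" "start js \<notin> R"
      using Cons.prems j \<open>js = k # ks\<close> by (auto simp: is_move_def start_def same_peg_def)
    then show ?thesis
      using Cons.IH[OF j(1)] Cons.prems \<open>js = k # ks\<close> by auto
  qed
qed

lemma merson_region_moves:
  assumes "merson_region R" "R \<subseteq> A" "list_all is_move ms" "jumps_lead A (concat ms) B"
    "ms \<noteq> []" "\<forall>m \<in> set ms. start m \<notin> R"
  shows "R \<subseteq> B \<and> landing (last (concat ms)) \<notin> R"
  using assms(2-)
proof (induction ms arbitrary: A)
  case Nil
  then show ?case by simp
next
  case (Cons m ms)
  obtain C where C: "jumps_lead A m C" "jumps_lead C (concat ms) B"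
    using Cons.prems by (auto simp: jumps_lead_append)
  have m: "R \<subseteq> C \<and> landing (last m) \<notin> R"
    using merson_region_move[OF assms(1) Cons.prems(1) _ C(1)] Cons.prems by simp
  show ?case
  proof (cases ms)
    case Nil
    then show ?thesis using C m by simp
  next
    case (Cons m' ms')
    then have "concat ms \<noteq> []"
      using Cons.prems by (auto simp: is_move_def)
    then show ?thesis
      using Cons.IH[of C] Cons.prems C m \<open>ms = m' # ms'\<close> by auto
  qed
qed

lemma landing_last:
  assumes "jumps_lead A js B" "js \<noteq> []"
  shows "landing (last js) \<in> B"
proof -
  obtain ks j where js: "js = ks @ [j]"
    using assms(2) by (cases js rule: rev_cases) auto
  then obtain C where "do_jump C j = B"
    using assms(1) by (auto simp: jumps_lead_append)
  then show ?thesis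
    using js by (cases j) auto
qed

text \<open>The last jumper is the survivor, so it cannot be a peg that stayed in its region.\<close>

lemma merson_region_start:
  assumes "merson_region R" "R \<subseteq> A" "list_all is_move ms" "jumps_lead A (concat ms) {t}"
    "ms \<noteq> []" "R \<noteq> {}"
  shows "\<exists>m \<in> set ms. start m \<in> R"
proof (rule ccontr)
  assume "\<not> ?thesis"
  then have "R \<subseteq> {t}" and last: "landing (last (concat ms)) \<notin> R"
    using merson_region_moves[OF assms(1-5)] by auto
  moreover have "landing (last (concat ms)) = t"
    using landing_last[OF assms(4)] assms(3,5) by (cases ms) (auto simp: is_move_def)
  ultimately show False
    using assms(6) by auto
qed

section \<open>The board, its eight regions and the lower bound\<close>

definition board :: "hole list" where
  "board = [(4,1),(3,2),(4,2),(5,2),(2,3),(3,3),(4,3),(5,3),(6,3),(1,4),(2,4),(3,4),(4,4),(5,4),(6,4),(7,4),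
    (2,5),(3,5),(4,5),(5,5),(6,5),(3,6),(4,6),(5,6),(4,7)]"

lemma diamond4_board [code]: "diamond4 = set board"
proof -
  \<comment> \<open>The finite box turns the comprehension into something that can be
    evaluated.\<close>
  have "diamond4 = Set.filter (\<lambda>(x, y). \<bar>x - 4\<bar> + \<bar>y - 4\<bar> \<le> 3) ({1..7} \<times> {1..7})"
    by (auto simp: diamond4_def)
  also have "\<dots> = set board"
    by code_simp
  finally show ?thesis .
qed

lemma directions_code [code]:
  "directions = set [(-1, -1), (-1, 0), (-1, 1), (0, -1), (0, 1), (1, -1), (1, 0), (1, 1)]"
  by (auto simp: directions_def)

definition regions :: "hole list list" where
  "regions = [[(1, 4)], [(7, 4)], [(4, 1)], [(4, 7)],
    [(2, 5), (3, 6)], [(6, 5), (5, 6)], [(2, 3), (3, 2)], [(6, 3), (5, 2)]]"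

definition full_regions :: "hole set \<Rightarrow> hole list list" where
  "full_regions A = filter (\<lambda>R. set R \<subseteq> A) regions"

lemma regions_disjoint:
  assumes "R \<in> set regions" "R' \<in> set regions" "h \<in> set R" "h \<in> set R'"
  shows "R = R'"
proof -
  have "\<forall>R \<in> set regions. \<forall>R' \<in> set regions. R = R' \<or> set R \<inter> set R' = {}"
    by code_simp
  then show ?thesis
    using assms by blast
qed

lemma distinct_regions: "distinct regions"
  by code_simp

lemma regions_merson:
  assumes "R \<in> set regions"
  shows "merson_region (set R)" "R \<noteq> []"
proof -
  have "\<forall>R \<in> set regions. merson_region (set R) \<and> R \<noteq> []"
    by code_simp
  then show "merson_region (set R)" "R \<noteq> []"
    using assms by auto
qed

text \<open>Each full region contains the start of some move, and disjointness makes these starts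
  distinct. Counting only moves that start in full regions lets the central game discount its first
  and last move, and lets the search locate the first move.\<close>

lemma full_regions_bound:
  assumes "list_all is_move ms" "jumps_lead A (concat ms) {t}" "ms \<noteq> []"
  shows "length (full_regions A) \<le>
    length (filter (\<lambda>m. start m \<in> set (concat (full_regions A))) ms)"
    (is "_ \<le> length (filter ?P ms)")
proof -
  have full: "R \<in> set regions" "set R \<subseteq> A" if "R \<in> set (full_regions A)" for R
    using that by (auto simp: full_regions_def)
  have "\<exists>s \<in> start ` set (filter ?P ms). s \<in> set R" if R: "R \<in> set (full_regions A)" for R
  proof -
    obtain m where "m \<in> set ms" "start m \<in> set R"
      using merson_region_start[OF _ _ assms, of "set R"] regions_merson[of R] full[OF R] by auto
    then show ?thesis
      using R by auto
  qed
  then obtain f where f: "f R \<in> start ` set (filter ?P ms)" "f R \<in> set R"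
    if "R \<in> set (full_regions A)" for R
    by metis
  have "distinct (full_regions A)"
    by (simp add: full_regions_def distinct_regions)
  then have "length (full_regions A) = card (set (full_regions A))"
    by (simp add: distinct_card)
  also have "\<dots> \<le> card (start ` set (filter ?P ms))"
  proof (rule card_inj_on_le)
    show "inj_on f (set (full_regions A))"
      by (rule inj_onI) (metis f(2) full(1) regions_disjoint)
  qed (use f(1) in auto)
  also have "\<dots> \<le> card (set (filter ?P ms))"
    by (rule card_image_le) simp
  also have "\<dots> \<le> length (filter ?P ms)"
    by (rule card_length)
  finally show ?thesis .
qed

section \<open>Parity and the central game\<close>

definition even_hole :: "hole \<Rightarrow> bool" where
  "even_hole h \<longleftrightarrow> even (fst h) \<and> even (snd h)"

lemma even_hole_landing: "even_hole (landing j) \<longleftrightarrow> even_hole (fst j)"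
  by (cases j) (auto simp: even_hole_def)

lemma even_hole_start:
  assumes "is_move m"
  shows "even_hole (landing (last m)) \<longleftrightarrow> even_hole (start m)"
  using assms
proof (induction m)
  case Nil
  then show ?case by (simp add: is_move_def)
next
  case (Cons j m)
  show ?case
  proof (cases m)
    case Nil
    then show ?thesis by (simp add: even_hole_landing start_def)
  next
    case (Cons k ks)
    then show ?thesis
      using Cons.IH Cons.prems even_hole_landing[of j]
      by (auto simp: is_move_def start_def same_peg_def)
  qed
qed

lemma central_game:
  assumes "list_all is_move ms" "jumps_lead (diamond4 - {center}) (concat ms) {center}"
  shows "10 \<le> length ms"
proof -
  let ?A = "diamond4 - {center}"
  let ?P = "\<lambda>m. start m \<in> set (concat regions)"
  have "full_regions ?A = regions"
    by code_simp
  moreover have "ms \<noteq> []"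
    using assms(2) by (auto simp: diamond4_def center_def)
  ultimately have bound: "length regions \<le> length (filter ?P ms)"
    using full_regions_bound[OF assms] by simp
  have eight: "length regions = 8"
    by (simp add: regions_def)
  obtain m ns where ns: "ms = m # ns"
    using \<open>ms \<noteq> []\<close> by (cases ms) auto
  \<comment> \<open>The first and the last move must be different moves to contribute two.\<close>
  have "ns \<noteq> []"
    using bound eight ns by (auto split: if_splits)
  then obtain ks n where ms: "ms = m # ks @ [n]"
    using ns by (cases ns rule: rev_cases) auto
  have not_region: "\<not> ?P k" if "even_hole (start k)" for k
  proof -
    have "\<forall>h \<in> set (concat regions). \<not> even_hole h"
      by code_simp
    then show ?thesis
      using that by blast
  qed
  have "even_hole center"
    by (simp add: even_hole_def center_def)
  moreover obtain j js where j: "m = j # js"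
    using assms(1) ms by (cases m) (auto simp: is_move_def)
  \<comment> \<open>The center is the only vacancy at the start.\<close>
  moreover have "landing j = center"
    using assms(2) ms j by (cases j) auto
  ultimately have "even_hole (start m)"
    using even_hole_landing[of j] by (simp add: start_def)
  obtain B where "jumps_lead B n {center}"
    using assms(2) ms by (auto simp: jumps_lead_append)
  then have "landing (last n) = center"
    using landing_last[of B n] assms(1) ms by (auto simp: is_move_def)
  then have "even_hole (start n)"
    using even_hole_start[of n] \<open>even_hole center\<close> assms(1) ms by auto
  then have "filter ?P ms = filter ?P ks"
    using ms not_region \<open>even_hole (start m)\<close> by simp
  then have "8 \<le> length (filter ?P ks)"
    using bound eight by (simp only:)
  then have "8 \<le> length ks"
    using length_filter_le order_trans by blast
  then show ?thesis
    using ms by simp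
qed

section \<open>Search through the positions where the bound is tight\<close>

lemma legal_jump_code [code]:
  "legal_jump A (p, v) \<longleftrightarrow>
     \<bar>fst (p + v + v) - 4\<bar> + \<bar>snd (p + v + v) - 4\<bar> \<le> 3 \<and>
     p + v + v \<notin> A \<and> p + v \<in> A \<and> p \<in> A \<and>
     \<bar>fst p - 4\<bar> + \<bar>snd p - 4\<bar> \<le> 3 \<and> v \<in> directions"
proof -
  \<comment> \<open>The diamond is convex and \<open>p + v\<close> is the midpoint of the two ends,
    so the code tests only the ends for lying on the board.\<close>
  have *: "p + v \<in> diamond4" if "p \<in> diamond4" "p + v + v \<in> diamond4"
    using that by (cases p; cases v) (auto simp: diamond4_def)
  show ?thesis
    using * by (auto simp: diamond4_def case_prod_beta)
qed


definition jumps_from :: "hole set \<Rightarrow> hole \<Rightarrow> jump list" where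
  "jumps_from A p = filter (legal_jump A) (map (Pair p)
     [(-1, -1), (-1, 0), (-1, 1), (0, -1), (0, 1), (1, -1), (1, 0), (1, 1)])"

lemma set_jumps_from: "j \<in> set (jumps_from A p) \<longleftrightarrow> legal_jump A j \<and> fst j = p"
proof -
  have "set (jumps_from A p) = {j \<in> Pair p ` directions. legal_jump A j}"
    unfolding jumps_from_def directions_code set_filter set_map by blast
  moreover have "j \<in> Pair p ` directions" if "legal_jump A j" "fst j = p"
  proof (rule image_eqI)
    show "j = (p, snd j)" "snd j \<in> directions"
      using that by (cases j; simp)+
  qed
  ultimately show ?thesis
    by auto
qed

text \<open>The number \<open>n\<close> is fuel: when it is exhausted, the answer is negative.\<close>

primrec all_continuations :: "(hole set \<Rightarrow> bool) \<Rightarrow> nat \<Rightarrow> hole set \<Rightarrow> jump \<Rightarrow> bool" where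
  "all_continuations P 0 A j \<longleftrightarrow> False"
| "all_continuations P (Suc n) A j \<longleftrightarrow>
     P (do_jump A j) \<and>
     list_all (all_continuations P n (do_jump A j)) (jumps_from (do_jump A j) (landing j))"

text \<open>\<open>P\<close> is tested after every jump, as a chain in the sense of
  \<open>is_move\<close> may stop after any of them.\<close>

lemma all_continuationsD:
  assumes "all_continuations P n A j" "is_move (j # js)" "jumps_lead A (j # js) B"
  shows "P B"
  using assms
proof (induction n arbitrary: A j js)
  case 0
  then show ?case by simp
next
  case (Suc n)
  show ?case
  proof (cases js)
    case Nil
    then show ?thesis using Suc.prems by simp
  next
    case (Cons k ks)
    then have "k \<in> set (jumps_from (do_jump A j) (landing j))"
      using Suc.prems by (auto simp: set_jumps_from is_move_def same_peg_def)
    then have "all_continuations P n (do_jump A j) k"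
      using Suc.prems(1) by (simp add: list_all_iff)
    then show ?thesis
      using Suc.IH[of "do_jump A j" k ks] Suc.prems Cons by (auto simp: is_move_def)
  qed
qed

text \<open>Each jump removes a peg, so on 25 holes the fuel 25 outlasts every chain.\<close>

definition all_moves_from :: "(hole set \<Rightarrow> bool) \<Rightarrow> hole set \<Rightarrow> hole \<Rightarrow> bool" where
  "all_moves_from P A p \<longleftrightarrow> list_all (all_continuations P 25 A) (jumps_from A p)"

lemma all_moves_fromD:
  assumes "all_moves_from P A (start m)" "is_move m" "jumps_lead A m B"
  shows "P B"
proof -
  obtain j js where m: "m = j # js"
    using assms(2) by (cases m) (auto simp: is_move_def)
  then have "all_continuations P 25 A j"
    using assms by (auto simp: all_moves_from_def list_all_iff set_jumps_from start_def)
  then show ?thesis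
    using all_continuationsD assms m by blast
qed

text \<open>A sufficient certificate that more than \<open>k\<close> moves are needed to reach a
  single peg. Two distinct pegs exclude the empty solution. It also fails when the bound is too weak
  to dictate where the next move starts.\<close>

fun insoluble :: "nat \<Rightarrow> hole set \<Rightarrow> bool" where
  "insoluble 0 A \<longleftrightarrow> (\<exists>p \<in> A. \<exists>q \<in> A. p \<noteq> q)"
| "insoluble (Suc k) A \<longleftrightarrow> (\<exists>p \<in> A. \<exists>q \<in> A. p \<noteq> q) \<and>
     (Suc k < length (full_regions A) \<or>
      Suc k = length (full_regions A) \<and>
      list_all (all_moves_from (insoluble k) A) (concat (full_regions A)))"

lemma insolubleD:
  assumes "insoluble k A" "list_all is_move ms" "jumps_lead A (concat ms) {t}"
  shows "k < length ms"
  using assms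
proof (induction k arbitrary: A ms)
  case 0
  then show ?case by (cases ms) auto
next
  case (Suc k)
  let ?P = "\<lambda>m. start m \<in> set (concat (full_regions A))"
  obtain m ns where ms: "ms = m # ns"
    using Suc.prems by (cases ms) auto
  have bound: "length (full_regions A) \<le> length (filter ?P ms)"
    using full_regions_bound[OF Suc.prems(2,3)] ms by blast
  show ?case
  proof (rule ccontr)
    assume few: "\<not> Suc k < length ms"
    then have tight: "Suc k = length (full_regions A)"
      "list_all (all_moves_from (insoluble k) A) (concat (full_regions A))"
      using Suc.prems(1) bound length_filter_le[of ?P ms] by auto
    \<comment> \<open>Otherwise the at most \<open>k\<close> moves in \<open>ns\<close> would have
      to open \<open>Suc k\<close> full regions.\<close>
    have "?P m"
    proof (rule ccontr)
      assume "\<not> ?P m"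
      then have "length (filter ?P ms) \<le> length ns"
        using ms length_filter_le[of ?P ns] by (simp only: filter.simps if_False)
      then show False
        using bound few tight(1) ms by simp
    qed
    then have "all_moves_from (insoluble k) A (start m)"
      using tight(2) by (simp only: list_all_iff)
    moreover obtain B where B: "jumps_lead A m B" "jumps_lead B (concat ns) {t}"
      using Suc.prems(3) ms by (auto simp: jumps_lead_append)
    ultimately have "insoluble k B"
      using all_moves_fromD Suc.prems(2) ms by auto
    then have "k < length ns"
      using Suc.IH B Suc.prems(2) ms by auto
    then show False
      using few ms by simp
  qed
qed

text \<open>The 13 vacancies outside the regions leave eight full regions and need no search; the
  other 12 leave exactly seven.\<close>

lemma insoluble_single_vacancy: "list_all (insoluble 7) (map (\<lambda>s. diamond4 - {s}) board)"
  by code_simp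

theorem theorem3:
  "\<not> (\<exists>ms. solution (diamond4 - {center}) {center} ms \<and> length ms < 10) \<and>
   (\<forall>s \<in> diamond4. \<forall>t \<in> diamond4.
      \<not> (\<exists>ms. solution (diamond4 - {s}) {t} ms \<and> length ms < 8))"
proof -
  have sol: "list_all is_move ms \<and> jumps_lead A (concat ms) B" if "solution A B ms" for A B ms
    using that by (auto simp: solution_def move_sequence_def is_move_def list_all_iff)
  have "10 \<le> length ms" if "solution (diamond4 - {center}) {center} ms" for ms
    using central_game sol[OF that] by blast
  moreover have "8 \<le> length ms" if "s \<in> diamond4" "solution (diamond4 - {s}) {t} ms" for s t ms
  proof -
    have "insoluble 7 (diamond4 - {s})"
      using insoluble_single_vacancy \<open>s \<in> diamond4\<close> by (simp add: list_all_iff diamond4_board)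
    then show ?thesis
      using insolubleD[of 7 "diamond4 - {s}" ms t] sol[OF that(2)] by simp
  qed
  ultimately show ?thesis
    by (metis not_less)
qed

end
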